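(* Let $\mathcal{X},\mathcal{Y}$ be finite dimensional Euclidean spaces, $\theta:\mathcal{X}\to(-\infty,\infty]$ a closed proper convex function with Fenchel conjugate $\theta^*$, $\mathcal{Q}:\mathcal{X}\to\mathcal{X}$ a self-adjoint positive semidefinite linear operator, $c\in\mathcal{X}$, $b\in\mathcal{Y}$, and $\mathcal{A}:\mathcal{X}\to\mathcal{Y}$ a surjective linear map such that there exists $x\in\operatorname{ri}(\operatorname{dom}\theta^* )$ with $\mathcal{A}x=b$. Let $\sigma>0$ and $\rho\in(0,2)$, and let $\{w^k\},\{y^k\},\{z^k\},\{x^k\}$ be the infinite sequences generated by the generalized modified ADMM described in the context. Define for $k\ge 0$ $$u^{k}:=x^k+\sigma\big(\rho\mathcal{A}^*y^{k+1}-(1-\rho)z^k-\rho\mathcal{Q}w^{k+1}-\rho c\big)=x^{k+1}-\sigma z^{k+1}.$$ Let $\mathcal{K}:=\{x\in\mathcal{X}\mid\mathcal{A}x=b\}$, $q(x):=\frac12\langle x,\mathcal{Q}x\rangle+\langle c,x\rangle$, and define $\Gamma:\mathcal{X}\to\mathcal{X}$ by $$\Gamma:=\mathcal{I}-\mathcal{J}_{\sigma\partial\theta^*}+\mathcal{J}_{\sigma\mathcal{N}_{\mathcal{K}}}\circ\big(2\mathcal{J}_{\sigma\partial\theta^*}-\mathcal{I}-\sigma\nabla q\circ\mathcal{J}_{\sigma\partial\theta^*}\big).$$ Then for all $k\ge0$, $$u^{k+1}=(1-\rho)u^k+\rho\,\Gamma(u^k).$$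
   Context: Each of $\mathcal{X},\mathcal{Y}$ carries an inner product $\langle\cdot,\cdot\rangle$ with induced norm $\|\cdot\|$; $\mathcal{A}^*$ is the adjoint of $\mathcal{A}$; $\mathcal{I}$ is the identity operator; $\operatorname{ri}$ denotes relative interior and $\operatorname{dom}$ effective domain. $\mathcal{N}_{\mathcal{K}}=\partial\delta_{\mathcal{K}}$ is the normal cone mapping of $\mathcal{K}$. For a maximal monotone operator $\mathcal{F}$ and $\sigma>0$, $\mathcal{J}_{\sigma\mathcal{F}}:=(\mathcal{I}+\sigma\mathcal{F})^{-1}$ is its (single-valued) resolvent; in particular $\mathcal{J}_{\sigma\mathcal{N}_{\mathcal{K}}}=\Pi_{\mathcal{K}}$ is the metric projection onto $\mathcal{K}$. Here $\nabla q(x)=\mathcal{Q}x+c$. The underlying problem is $\min_{x\in\mathcal{X}}\{\theta^*(x)+\frac12\langle x,\mathcal{Q}x\rangle+\langle c,x\rangle : \mathcal{A}x=b\}$, with dual (in minimization form) $\min_{w,y,z}\{\frac12\langle w,\mathcal{Q}w\rangle-\langle b,y\rangle+\theta(-z) : -\mathcal{Q}w+\mathcal{A}^*y+z=c\}$, $w,z\in\mathcal{X}$, $y\in\mathcal{Y}$. For $\sigma>0$ the augmented Lagrangian of the dual is $$\mathcal{L}_\sigma(w,y,z;x):=\tfrac12\langle w,\mathcal{Q}w\rangle-\langle b,y\rangle+\theta(-z)+\langle\mathcal{A}^*y+z-\mathcal{Q}w-c,x\rangle+\tfrac\sigma2\|\mathcal{A}^*y+z-\mathcal{Q}w-c\|^2.$$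 Generalized modified ADMM: given $\sigma>0$, $\rho\in(0,2)$, $z^0$ with $-z^0\in\operatorname{dom}\theta$, and $x^0\in\mathcal{X}$, for $k=0,1,\ldots$: Step 1: $w^{k+1}:=x^k$; Step 2: $y^{k+1}:=\operatorname{argmin}_{y\in\mathcal{Y}}\mathcal{L}_\sigma(w^{k+1},y,z^k;x^k)$; Step 3: $z^{k+1}:=\operatorname{argmin}_{z\in\mathcal{X}}\{\theta(-z)+\langle z,x^k\rangle+\frac\sigma2\|\rho\mathcal{A}^*y^{k+1}-(1-\rho)z^k+z-\rho\mathcal{Q}w^{k+1}-\rho c\|^2\}$; Step 4: $x^{k+1}:=x^k+\sigma(\rho\mathcal{A}^*y^{k+1}-(1-\rho)z^k+z^{k+1}-\rho\mathcal{Q}w^{k+1}-\rho c)$. *)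

theory Defs
  imports "HOL-Analysis.Analysis"
begin

text \<open>Functions with values in \<open>(-\<infinity>, \<infinity>]\<close> are rendered as \<^typ>\<open>ereal\<close>-valued functions that satisfy
  \<open>proper_function\<close>.\<close>

definition epigraph :: "('a \<Rightarrow> ereal) \<Rightarrow> ('a \<times> real) set" where
  "epigraph f = {(x, r). f x \<le> ereal r}"

definition effective_domain :: "('a \<Rightarrow> ereal) \<Rightarrow> 'a set" where
  "effective_domain f = {x. f x < \<infinity>}"

definition proper_function :: "('a \<Rightarrow> ereal) \<Rightarrow> bool" where
  "proper_function f \<longleftrightarrow> (\<forall>x. f x \<noteq> -\<infinity>) \<and> effective_domain f \<noteq> {}"

definition closed_proper_convex :: "('a::euclidean_space \<Rightarrow> ereal) \<Rightarrow> bool" where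
  "closed_proper_convex f \<longleftrightarrow> proper_function f \<and> closed (epigraph f) \<and> convex (epigraph f)"

definition fenchel_conjugate :: "('a::euclidean_space \<Rightarrow> ereal) \<Rightarrow> 'a \<Rightarrow> ereal" where
  "fenchel_conjugate f = (\<lambda>v. SUP x. ereal (v \<bullet> x) - f x)"

text \<open>For proper \<open>f\<close> the subdifferential is empty outside the effective domain.\<close>

definition subdifferential :: "('a::euclidean_space \<Rightarrow> ereal) \<Rightarrow> 'a \<Rightarrow> 'a set" where
  "subdifferential f x = {g. \<forall>y. f x + ereal (g \<bullet> (y - x)) \<le> f y}"

definition convex_indicator :: "'a set \<Rightarrow> 'a \<Rightarrow> ereal" where
  "convex_indicator K x = (if x \<in> K then 0 else \<infinity>)"

definition normal_cone :: "'a::euclidean_space set \<Rightarrow> 'a \<Rightarrow> 'a set" where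
  "normal_cone K = subdifferential (convex_indicator K)"

text \<open>The value at \<open>v\<close> is the unique \<open>x\<close> with \<open>v \<in> x + \<sigma> F x\<close>. It is only meaningful when \<open>x\<close>
  exists and is unique, as is the case for maximal monotone \<open>F\<close> and \<open>\<sigma> > 0\<close>.\<close>

definition resolvent :: "real \<Rightarrow> ('a::euclidean_space \<Rightarrow> 'a set) \<Rightarrow> 'a \<Rightarrow> 'a" where
  "resolvent \<sigma> F v = (THE x. \<exists>g\<in>F x. v = x + \<sigma> *\<^sub>R g)"

definition gradient :: "('a::euclidean_space \<Rightarrow> real) \<Rightarrow> 'a \<Rightarrow> 'a" where
  "gradient f x = (THE D. GDERIV f x :> D)"

definition quad :: "('a::euclidean_space \<Rightarrow> 'a) \<Rightarrow> 'a \<Rightarrow> 'a \<Rightarrow> real" where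
  "quad Q c x = 1/2 * (x \<bullet> Q x) + c \<bullet> x"

definition aug_lagrangian ::
  "('a::euclidean_space \<Rightarrow> ereal) \<Rightarrow> ('a \<Rightarrow> 'a) \<Rightarrow> 'a \<Rightarrow> ('a \<Rightarrow> 'b::euclidean_space) \<Rightarrow> 'b \<Rightarrow> real
    \<Rightarrow> 'a \<Rightarrow> 'b \<Rightarrow> 'a \<Rightarrow> 'a \<Rightarrow> ereal" where
  "aug_lagrangian \<theta> Q c A b \<sigma> w y z x =
     ereal (1/2 * (w \<bullet> Q w) - b \<bullet> y) + \<theta> (- z)
     + ereal ((adjoint A y + z - Q w - c) \<bullet> x
              + \<sigma> / 2 * (norm (adjoint A y + z - Q w - c))\<^sup>2)"

text \<open>\<open>w 0\<close> and \<open>y 0\<close> play no role and are left unconstrained.\<close>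

definition generalized_modified_ADMM ::
  "('a::euclidean_space \<Rightarrow> ereal) \<Rightarrow> ('a \<Rightarrow> 'a) \<Rightarrow> 'a \<Rightarrow> ('a \<Rightarrow> 'b::euclidean_space) \<Rightarrow> 'b
    \<Rightarrow> real \<Rightarrow> real \<Rightarrow> (nat \<Rightarrow> 'a) \<Rightarrow> (nat \<Rightarrow> 'b) \<Rightarrow> (nat \<Rightarrow> 'a) \<Rightarrow> (nat \<Rightarrow> 'a) \<Rightarrow> bool" where
  "generalized_modified_ADMM \<theta> Q c A b \<sigma> \<rho> w y z x \<longleftrightarrow>
     - z 0 \<in> effective_domain \<theta> \<and>
     (\<forall>k. w (Suc k) = x k \<and>
          is_arg_min (\<lambda>y'. aug_lagrangian \<theta> Q c A b \<sigma> (w (Suc k)) y' (z k) (x k))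
            (\<lambda>_. True) (y (Suc k)) \<and>
          is_arg_min (\<lambda>z'. \<theta> (- z') + ereal (z' \<bullet> x k
              + \<sigma> / 2 * (norm (\<rho> *\<^sub>R adjoint A (y (Suc k)) - (1 - \<rho>) *\<^sub>R z k + z'
                               - \<rho> *\<^sub>R Q (w (Suc k)) - \<rho> *\<^sub>R c))\<^sup>2))
            (\<lambda>_. True) (z (Suc k)) \<and>
          x (Suc k) = x k + \<sigma> *\<^sub>R (\<rho> *\<^sub>R adjoint A (y (Suc k)) - (1 - \<rho>) *\<^sub>R z k + z (Suc k)
                                    - \<rho> *\<^sub>R Q (w (Suc k)) - \<rho> *\<^sub>R c))"

definition Gamma_op ::
  "('a::euclidean_space \<Rightarrow> ereal) \<Rightarrow> ('a \<Rightarrow> 'a) \<Rightarrow> 'a \<Rightarrow> ('a \<Rightarrow> 'b::euclidean_space) \<Rightarrow> 'b \<Rightarrow> real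
    \<Rightarrow> 'a \<Rightarrow> 'a" where
  "Gamma_op \<theta> Q c A b \<sigma> v =
     (let J\<theta> = resolvent \<sigma> (subdifferential (fenchel_conjugate \<theta>));
          JK = resolvent \<sigma> (normal_cone {x. A x = b})
      in v - J\<theta> v + JK (2 *\<^sub>R J\<theta> v - v - \<sigma> *\<^sub>R gradient (quad Q c) (J\<theta> v)))"

end

theory Submission
  imports Defs
begin

text \<open>The optimality condition of the \<open>z\<close>-step is \<open>x\<^sub>k\<^sub>+\<^sub>1 \<in> \<partial>\<theta>(-z\<^sub>k\<^sub>+\<^sub>1)\<close>, hence \<open>-z\<^sub>k\<^sub>+\<^sub>1 \<in> \<partial>\<theta>\<^sup>*(x\<^sub>k\<^sub>+\<^sub>1)\<close>;
  as \<open>u\<^sub>k = x\<^sub>k\<^sub>+\<^sub>1 - \<sigma> z\<^sub>k\<^sub>+\<^sub>1\<close>, the resolvent of \<open>\<partial>\<theta>\<^sup>*\<close> maps \<open>u\<^sub>k\<close> to \<open>x\<^sub>k\<^sub>+\<^sub>1\<close>. The optimality condition of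
  the \<open>y\<close>-step says that \<open>p\<^sub>k = x\<^sub>k + \<sigma> (A\<^sup>* y\<^sub>k\<^sub>+\<^sub>1 + z\<^sub>k - Q x\<^sub>k - c)\<close> lies in \<open>K\<close>; since the range of \<open>A\<^sup>*\<close> is
  normal to \<open>K\<close>, \<open>p\<^sub>k\<close> is the projection of \<open>x\<^sub>k + \<sigma> (z\<^sub>k - Q x\<^sub>k - c)\<close>. Finally
  \<open>u\<^sub>k = x\<^sub>k - \<sigma> z\<^sub>k + \<rho> (p\<^sub>k - x\<^sub>k)\<close>, and \<open>x\<^sub>k - \<sigma> z\<^sub>k = u\<^sub>k\<^sub>-\<^sub>1\<close> for \<open>k > 0\<close>.\<close>

text \<open>Comparison with a point of the effective domain excludes the value
  \<open>\<infinity>\<close>, so subgradient inequalities between extended reals reduce to real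
  ones.\<close>

lemma subdifferential_finite:
  assumes "proper_function f" and "g \<in> subdifferential f x"
  shows "\<bar>f x\<bar> \<noteq> \<infinity>"
proof -
  obtain y where "f y < \<infinity>"
    using assms(1) by (auto simp: proper_function_def effective_domain_def)
  moreover have "f x + ereal (g \<bullet> (y - x)) \<le> f y"
    using assms(2) by (simp add: subdifferential_def)
  ultimately show ?thesis
    using assms(1) by (cases "f x") (auto simp: proper_function_def)
qed

lemma subdifferential_monotone:
  assumes f: "proper_function f"
    and g: "g \<in> subdifferential f x" and h: "h \<in> subdifferential f y"
  shows "0 \<le> (g - h) \<bullet> (x - y)"
proof -
  obtain r s where rs: "f x = ereal r" "f y = ereal s"
    using subdifferential_finite[OF f g] subdifferential_finite[OF f h]
    by (metis abs_neq_infinity_cases)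
  have "f x + ereal (g \<bullet> (y - x)) \<le> f y" "f y + ereal (h \<bullet> (x - y)) \<le> f x"
    using g h by (simp_all add: subdifferential_def)
  then show ?thesis
    by (simp add: rs algebra_simps)
qed

text \<open>\<open>resolvent\<close> is a definite description: \<open>g\<close> witnesses
  existence, and uniqueness follows from monotonicity, since two solutions differ by
  \<open>- \<sigma> (g - h)\<close>, which monotonicity allows only if \<open>g = h\<close>.\<close>

lemma resolvent_subdifferential_eqI:
  assumes f: "proper_function f" and \<sigma>: "0 < \<sigma>" and g: "g \<in> subdifferential f x"
    and v: "v = x + \<sigma> *\<^sub>R g"
  shows "resolvent \<sigma> (subdifferential f) v = x"
  unfolding resolvent_def
proof (rule the_equality)
  show "\<exists>g\<in>subdifferential f x. v = x + \<sigma> *\<^sub>R g"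
    using g v by blast
next
  fix y
  assume "\<exists>h\<in>subdifferential f y. v = y + \<sigma> *\<^sub>R h"
  then obtain h where h: "h \<in> subdifferential f y" and "v = y + \<sigma> *\<^sub>R h"
    by blast
  with v have eq: "x - y = - \<sigma> *\<^sub>R (g - h)"
    by (simp add: algebra_simps)
  have "0 \<le> - \<sigma> * ((g - h) \<bullet> (g - h))"
    using subdifferential_monotone[OF f g h] by (simp add: eq)
  then have "(g - h) \<bullet> (g - h) \<le> 0"
    using \<sigma> by (simp add: mult_le_0_iff)
  then have "g - h = 0"
    by (metis inner_eq_zero_iff inner_ge_zero order_antisym)
  then show "y = x"
    using eq by simp
qed

lemma proper_convex_indicator: "K \<noteq> {} \<Longrightarrow> proper_function (convex_indicator K)"
  by (auto simp: proper_function_def effective_domain_def convex_indicator_def)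

lemma normal_coneI:
  assumes "p \<in> K" and "\<And>h. h \<in> K \<Longrightarrow> g \<bullet> (h - p) \<le> 0"
  shows "g \<in> normal_cone K p"
  using assms by (auto simp: normal_cone_def subdifferential_def convex_indicator_def)

text \<open>Equality case of the Fenchel-Young inequality: the subgradient inequality at
  \<open>v\<close>, rearranged, says that \<open>v\<close> attains the supremum defining the
  conjugate at \<open>g\<close>.\<close>

lemma fenchel_conjugate_eq:
  assumes f: "proper_function f" and g: "g \<in> subdifferential f v"
  shows "fenchel_conjugate f g = ereal (g \<bullet> v) - f v"
  unfolding fenchel_conjugate_def
proof (rule SUP_eqI)
  fix y
  obtain r where r: "f v = ereal r"
    using subdifferential_finite[OF f g] by (metis abs_neq_infinity_cases)
  have "f v + ereal (g \<bullet> (y - v)) \<le> f y"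
    using g by (simp add: subdifferential_def)
  then show "ereal (g \<bullet> y) - f y \<le> ereal (g \<bullet> v) - f v"
    by (cases "f y") (auto simp: r algebra_simps)
qed simp

text \<open>The one subgradient serves twice: \<open>f v\<close> is finite, which bounds the
  conjugate below by an affine function, and the conjugate is finite at \<open>g\<close>.\<close>

lemma proper_fenchel_conjugate:
  assumes f: "proper_function f" and g: "g \<in> subdifferential f v"
  shows "proper_function (fenchel_conjugate f)"
proof -
  obtain r where r: "f v = ereal r"
    using subdifferential_finite[OF f g] by (metis abs_neq_infinity_cases)
  have "ereal (h \<bullet> v) - f v \<le> fenchel_conjugate f h" for h
    unfolding fenchel_conjugate_def by (rule SUP_upper) simp
  then have "fenchel_conjugate f h \<noteq> -\<infinity>" for h
    by (metis r ereal_minus(1) MInfty_neq_ereal(1) ereal_infty_less_eq(2))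
  moreover have "fenchel_conjugate f g < \<infinity>"
    by (simp add: fenchel_conjugate_eq[OF f g] r)
  ultimately show ?thesis
    by (auto simp: proper_function_def effective_domain_def)
qed

lemma subdifferential_fenchel_conjugate:
  assumes f: "proper_function f" and g: "g \<in> subdifferential f v"
  shows "v \<in> subdifferential (fenchel_conjugate f) g"
  unfolding subdifferential_def
proof (intro CollectI allI)
  fix h
  obtain r where r: "f v = ereal r"
    using subdifferential_finite[OF f g] by (metis abs_neq_infinity_cases)
  have "ereal (h \<bullet> v) - f v \<le> fenchel_conjugate f h"
    unfolding fenchel_conjugate_def by (rule SUP_upper) simp
  then show "fenchel_conjugate f g + ereal (v \<bullet> (h - g)) \<le> fenchel_conjugate f h"
    by (simp add: fenchel_conjugate_eq[OF f g] r inner_diff_right inner_commute)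
qed

text \<open>First-order optimality along a segment: divide by \<open>t\<close> and let
  \<open>t\<close> tend to 0 from the right.\<close>

lemma affine_nonneg_imp_const_nonneg:
  fixes a B :: real
  assumes "\<And>t. 0 < t \<Longrightarrow> t < 1 \<Longrightarrow> 0 \<le> t * a + t\<^sup>2 * B"
  shows "0 \<le> a"
proof (rule tendsto_lowerbound)
  show "((\<lambda>t. a + t * B) \<longlongrightarrow> a) (at_right 0)"
    by (auto intro!: tendsto_eq_intros)
  have "0 \<le> a + t * B" if "0 < t" "t < 1" for t
  proof -
    have "0 \<le> t * (a + t * B)"
      using assms[OF that] by (simp add: algebra_simps power2_eq_square)
    then show ?thesis
      using that by (simp add: zero_le_mult_iff)
  qed
  then show "\<forall>\<^sub>F t in at_right 0. 0 \<le> a + t * B"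
    by (auto simp: eventually_at_right_field intro!: exI[of _ 1])
qed simp

lemma norm_add_scaleR_square:
  fixes v d :: "'a::real_inner"
  shows "(norm (v + t *\<^sub>R d))\<^sup>2 = (norm v)\<^sup>2 + 2 * t * (v \<bullet> d) + t\<^sup>2 * (norm d)\<^sup>2"
  using dot_norm[of v "t *\<^sub>R d"] by (simp add: power_mult_distrib)

lemma convex_epigraph_le:
  assumes "convex (epigraph f)" and "f v \<le> ereal r" and "f v' \<le> ereal r'"
    and "0 \<le> t" and "t \<le> 1"
  shows "f (v + t *\<^sub>R (v' - v)) \<le> ereal (r + t * (r' - r))"
proof -
  have "(1 - t) *\<^sub>R (v, r) + t *\<^sub>R (v', r') \<in> epigraph f"
    using assms by (intro convexD) (auto simp: epigraph_def)
  then show ?thesis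
    by (simp add: epigraph_def algebra_simps)
qed

text \<open>Fermat's rule for a convex function plus a smooth quadratic, whose gradient at
  \<open>z\<close> is \<open>x + \<sigma> (z + s)\<close>. The reflection in \<open>f (- z')\<close>
  cancels the minus sign in front of this gradient.\<close>

lemma arg_min_proximal_subdifferential:
  fixes f :: "'a::euclidean_space \<Rightarrow> ereal"
  assumes f: "proper_function f" "convex (epigraph f)"
    and min: "is_arg_min (\<lambda>z'. f (- z') + ereal (z' \<bullet> x + \<sigma> / 2 * (norm (z' + s))\<^sup>2)) (\<lambda>_. True) z"
  shows "x + \<sigma> *\<^sub>R (z + s) \<in> subdifferential f (- z)"
proof -
  let ?\<phi> = "\<lambda>z'. z' \<bullet> x + \<sigma> / 2 * (norm (z' + s))\<^sup>2"
  have le: "f (- z) + ereal (?\<phi> z) \<le> f (- z') + ereal (?\<phi> z')" for z'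
    using min by (simp add: is_arg_min_linorder)
  obtain v0 where "f v0 < \<infinity>"
    using f(1) by (auto simp: proper_function_def effective_domain_def)
  with le[of "- v0"] have "f (- z) \<noteq> \<infinity>"
    by auto
  moreover have nMI: "f v \<noteq> -\<infinity>" for v
    using f(1) by (simp add: proper_function_def)
  ultimately obtain r where r: "f (- z) = ereal r"
    by (metis ereal_cases)
  show ?thesis
    unfolding subdifferential_def
  proof (intro CollectI allI)
    fix v
    show "f (- z) + ereal ((x + \<sigma> *\<^sub>R (z + s)) \<bullet> (v - - z)) \<le> f v"
    proof (cases "f v")
      case (real r')
      \<comment> \<open>Moving \<open>z\<close> by \<open>t d\<close> moves \<open>- z\<close> the
        fraction \<open>t\<close> of the way to \<open>v\<close>, where convexity of
        \<open>f\<close> applies.\<close>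
      define d where "d = - v - z"
      have "0 \<le> t * (r' - r + d \<bullet> (x + \<sigma> *\<^sub>R (z + s))) + t\<^sup>2 * (\<sigma> / 2 * (norm d)\<^sup>2)"
        if t: "0 < t" "t < 1" for t
      proof -
        have "f (- z + t *\<^sub>R (v - - z)) \<le> ereal (r + t * (r' - r))"
          using t by (intro convex_epigraph_le f) (simp_all add: r real)
        also have "- z + t *\<^sub>R (v - - z) = - (z + t *\<^sub>R d)"
          by (simp add: d_def algebra_simps)
        finally have "f (- (z + t *\<^sub>R d)) \<le> ereal (r + t * (r' - r))" .
        then have "ereal r + ereal (?\<phi> z) \<le> ereal (r + t * (r' - r)) + ereal (?\<phi> (z + t *\<^sub>R d))"
          using le[of "z + t *\<^sub>R d"] unfolding r
          by (blast intro: order_trans add_right_mono)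
        then have "?\<phi> z \<le> t * (r' - r) + ?\<phi> (z + t *\<^sub>R d)"
          by simp
        moreover have "?\<phi> (z + t *\<^sub>R d)
            = ?\<phi> z + t * (d \<bullet> (x + \<sigma> *\<^sub>R (z + s))) + t\<^sup>2 * (\<sigma> / 2 * (norm d)\<^sup>2)"
          unfolding add.assoc[of z _ s] add.commute[of _ s] add.assoc[of s z, symmetric]
            norm_add_scaleR_square
          by (simp add: algebra_simps inner_commute[of d])
        ultimately show ?thesis
          unfolding distrib_left[of t "r' - r"] by linarith
      qed
      then have "0 \<le> r' - r + d \<bullet> (x + \<sigma> *\<^sub>R (z + s))"
        by (rule affine_nonneg_imp_const_nonneg)
      moreover have "d \<bullet> (x + \<sigma> *\<^sub>R (z + s)) = - ((x + \<sigma> *\<^sub>R (z + s)) \<bullet> (v - - z))"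
        by (simp add: d_def inner_commute[of "x + _"] flip: inner_minus_left)
      ultimately show ?thesis
        by (simp add: r real)
    next
      case MInf
      then show ?thesis using nMI by blast
    qed simp
  qed
qed

text \<open>The gradient of the augmented Lagrangian in \<open>y\<close> is the residual
  \<open>A p - b\<close> at the updated multiplier \<open>p\<close>. Finiteness of
  \<open>\<theta> (- z)\<close> lets this term cancel when values are compared.\<close>

lemma arg_min_aug_lagrangian_feasible:
  fixes A :: "'a::euclidean_space \<Rightarrow> 'b::euclidean_space"
  assumes A: "linear A" and fin: "\<bar>\<theta> (- z)\<bar> \<noteq> \<infinity>"
    and min: "is_arg_min (\<lambda>y'. aug_lagrangian \<theta> Q c A b \<sigma> w y' z x) (\<lambda>_. True) y"
  shows "A (x + \<sigma> *\<^sub>R (adjoint A y + z - Q w - c)) = b"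
proof -
  let ?r = "\<lambda>y. adjoint A y + z - Q w - c"
  let ?p = "x + \<sigma> *\<^sub>R ?r y"
  let ?\<psi> = "\<lambda>y. ?r y \<bullet> x + \<sigma> / 2 * (norm (?r y))\<^sup>2 - b \<bullet> y"
  obtain r where r: "\<theta> (- z) = ereal r"
    using fin by (metis abs_neq_infinity_cases)
  have le: "?\<psi> y \<le> ?\<psi> y'" for y'
  proof -
    have "aug_lagrangian \<theta> Q c A b \<sigma> w y z x \<le> aug_lagrangian \<theta> Q c A b \<sigma> w y' z x"
      using min by (simp add: is_arg_min_linorder)
    then show ?thesis
      by (simp add: aug_lagrangian_def r)
  qed
  have "0 \<le> d \<bullet> (A ?p - b)" for d
  proof (rule affine_nonneg_imp_const_nonneg)
    fix t :: real
    have r_step: "?r (y + t *\<^sub>R d) = ?r y + t *\<^sub>R adjoint A d"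
      using adjoint_linear[OF A] by (simp add: linear_add linear_scale)
    have "?\<psi> (y + t *\<^sub>R d) - ?\<psi> y = t * (adjoint A d \<bullet> x + \<sigma> * (adjoint A d \<bullet> ?r y) - b \<bullet> d)
        + t\<^sup>2 * (\<sigma> / 2 * (norm (adjoint A d))\<^sup>2)"
      unfolding r_step norm_add_scaleR_square inner_commute[of "?r y" "adjoint A d"]
      by (simp only: inner_add_left inner_add_right inner_scaleR_left inner_scaleR_right
          inner_commute[of b] distrib_left right_diff_distrib) simp
    also have "adjoint A d \<bullet> x + \<sigma> * (adjoint A d \<bullet> ?r y) - b \<bullet> d = adjoint A d \<bullet> ?p - b \<bullet> d"
      by (simp add: inner_add_right)
    also have "\<dots> = d \<bullet> (A ?p - b)"
      using adjoint_works[OF A, of ?p d] by (simp only: inner_diff_right inner_commute)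
    finally show "0 \<le> t * (d \<bullet> (A ?p - b)) + t\<^sup>2 * (\<sigma> / 2 * (norm (adjoint A d))\<^sup>2)"
      using le[of "y + t *\<^sub>R d"] by linarith
  qed
  \<comment> \<open>The steepest descent direction as test direction forces the residual to
    vanish.\<close>
  from this[of "- (A ?p - b)"] have "(A ?p - b) \<bullet> (A ?p - b) \<le> 0"
    by (simp only: inner_minus_left neg_0_le_iff_le)
  then show ?thesis
    by (metis inner_eq_zero_iff inner_ge_zero order_antisym right_minus_eq)
qed

lemma resolvent_normal_cone_affine:
  fixes A :: "'a::euclidean_space \<Rightarrow> 'b::euclidean_space"
  assumes A: "linear A" and \<sigma>: "0 < \<sigma>" and p: "A p = b"
  shows "resolvent \<sigma> (normal_cone {x. A x = b}) (p - \<sigma> *\<^sub>R adjoint A y) = p"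
proof -
  have "- adjoint A y \<in> normal_cone {x. A x = b} p"
  proof (rule normal_coneI)
    fix h
    assume "h \<in> {x. A x = b}"
    then have "A (h - p) = 0"
      using A p by (simp add: linear_diff)
    then show "- adjoint A y \<bullet> (h - p) \<le> 0"
      using adjoint_works[OF A, of "h - p" y] by (simp add: inner_commute)
  qed (simp add: p)
  then show ?thesis
    using p \<sigma> unfolding normal_cone_def
    by (intro resolvent_subdifferential_eqI proper_convex_indicator) auto
qed

text \<open>Self-adjointness merges the two halves of the derivative of
  \<open>1/2 * (x \<bullet> Q x)\<close>; uniqueness of derivatives resolves the definite
  description.\<close>

lemma gradient_quad:
  fixes Q :: "'a::euclidean_space \<Rightarrow> 'a"
  assumes Q: "linear Q" and self_adj: "adjoint Q = Q"
  shows "gradient (quad Q c) x = Q x + c"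
proof -
  have bl: "bounded_linear Q"
    using Q by (simp add: linear_conv_bounded_linear)
  have sym: "x \<bullet> Q h = Q x \<bullet> h" for h
    using adjoint_works[OF Q, of x h] self_adj by simp
  have deriv: "GDERIV (quad Q c) x :> Q x + c"
    unfolding gderiv_def quad_def
    by (rule derivative_eq_intros bounded_linear_imp_has_derivative[OF bl] refl ext)+
      (simp add: sym inner_add_right inner_commute)
  show ?thesis
    unfolding gradient_def
  proof (rule the_equality)
    fix D
    assume "GDERIV (quad Q c) x :> D"
    then have "(\<lambda>h. h \<bullet> D) = (\<lambda>h. h \<bullet> (Q x + c))"
      using deriv unfolding gderiv_def by (rule has_derivative_unique)
    then show "D = Q x + c"
      by (metis vector_eq_ldot)
  qed (rule deriv)
qed

theorem proposition2:
  fixes \<theta> :: "'a::euclidean_space \<Rightarrow> ereal"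
    and Q :: "'a \<Rightarrow> 'a" and c :: 'a
    and A :: "'a \<Rightarrow> 'b::euclidean_space" and b :: 'b
    and \<sigma> \<rho> :: real
    and w z x u :: "nat \<Rightarrow> 'a" and y :: "nat \<Rightarrow> 'b"
  assumes "closed_proper_convex \<theta>"
    and "linear Q" and "adjoint Q = Q" and "\<forall>v. 0 \<le> v \<bullet> Q v"
    and "linear A" and "surj A"
    and "\<exists>v \<in> rel_interior (effective_domain (fenchel_conjugate \<theta>)). A v = b"
    and "\<sigma> > 0" and "0 < \<rho>" and "\<rho> < 2"
    and "generalized_modified_ADMM \<theta> Q c A b \<sigma> \<rho> w y z x"
    and "\<forall>k. u k = x k + \<sigma> *\<^sub>R (\<rho> *\<^sub>R adjoint A (y (Suc k)) - (1 - \<rho>) *\<^sub>R z k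
                              - \<rho> *\<^sub>R Q (w (Suc k)) - \<rho> *\<^sub>R c)"
  shows "\<forall>k. u k = x (Suc k) - \<sigma> *\<^sub>R z (Suc k)
           \<and> u (Suc k) = (1 - \<rho>) *\<^sub>R u k + \<rho> *\<^sub>R Gamma_op \<theta> Q c A b \<sigma> (u k)"
proof -
  note \<sigma> = \<open>\<sigma> > 0\<close>
  have \<theta>: "proper_function \<theta>" "convex (epigraph \<theta>)"
    using assms(1) by (simp_all add: closed_proper_convex_def)
  define p where "p k = x k + \<sigma> *\<^sub>R (adjoint A (y (Suc k)) + z k - Q (x k) - c)" for k
  have w: "w (Suc k) = x k"
    and y_min: "is_arg_min (\<lambda>y'. aug_lagrangian \<theta> Q c A b \<sigma> (w (Suc k)) y' (z k) (x k))
            (\<lambda>_. True) (y (Suc k))"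
    and z_min: "is_arg_min (\<lambda>z'. \<theta> (- z') + ereal (z' \<bullet> x k
              + \<sigma> / 2 * (norm (\<rho> *\<^sub>R adjoint A (y (Suc k)) - (1 - \<rho>) *\<^sub>R z k + z'
                               - \<rho> *\<^sub>R Q (w (Suc k)) - \<rho> *\<^sub>R c))\<^sup>2))
            (\<lambda>_. True) (z (Suc k))"
    and x_step: "x (Suc k) = x k + \<sigma> *\<^sub>R (\<rho> *\<^sub>R adjoint A (y (Suc k)) - (1 - \<rho>) *\<^sub>R z k + z (Suc k)
                                    - \<rho> *\<^sub>R Q (w (Suc k)) - \<rho> *\<^sub>R c)"
    and z0: "- z 0 \<in> effective_domain \<theta>" for k
    using assms(11) unfolding generalized_modified_ADMM_def by blast+
  have u: "u k = x k + \<sigma> *\<^sub>R (\<rho> *\<^sub>R adjoint A (y (Suc k)) - (1 - \<rho>) *\<^sub>R z k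
                              - \<rho> *\<^sub>R Q (w (Suc k)) - \<rho> *\<^sub>R c)" for k
    using assms(12) by blast
  have u_x: "u k = x (Suc k) - \<sigma> *\<^sub>R z (Suc k)" for k
    unfolding u x_step[of k] by (simp add: algebra_simps)
  \<comment> \<open>Splitting \<open>-(1 - \<rho>) z\<close> into \<open>-z + \<rho> z\<close>
    collects everything that carries \<open>\<rho>\<close> into a multiple of
    \<open>p k - x k\<close>.\<close>
  have u_p: "u k = x k - \<sigma> *\<^sub>R z k + \<rho> *\<^sub>R (p k - x k)" for k
    unfolding u p_def w by (simp add: algebra_simps)
  have x_subdiff: "x (Suc k) \<in> subdifferential \<theta> (- z (Suc k))" for k
  proof -
    let ?s = "\<rho> *\<^sub>R adjoint A (y (Suc k)) - (1 - \<rho>) *\<^sub>R z k - \<rho> *\<^sub>R Q (w (Suc k)) - \<rho> *\<^sub>R c"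
    have s: "\<rho> *\<^sub>R adjoint A (y (Suc k)) - (1 - \<rho>) *\<^sub>R z k + z'
        - \<rho> *\<^sub>R Q (w (Suc k)) - \<rho> *\<^sub>R c = z' + ?s" for z'
      by simp
    show ?thesis
      using arg_min_proximal_subdifferential[OF \<theta> z_min[of k, unfolded s]] x_step[of k, unfolded s]
      by simp
  qed
  \<comment> \<open>The starting point is finite by assumption; later iterates are finite because a
    subgradient exists there.\<close>
  have "\<bar>\<theta> (- z k)\<bar> \<noteq> \<infinity>" for k
  proof (cases k)
    case 0
    then show ?thesis
      using z0 \<theta>(1) by (auto simp: effective_domain_def proper_function_def)
  next
    case (Suc j)
    then show ?thesis
      using subdifferential_finite[OF \<theta>(1) x_subdiff] by simp
  qed
  then have p: "A (p k) = b" for k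
    using arg_min_aug_lagrangian_feasible[OF \<open>linear A\<close> _ y_min[of k]] by (simp add: p_def w)
  have "u (Suc k) = (1 - \<rho>) *\<^sub>R u k + \<rho> *\<^sub>R Gamma_op \<theta> Q c A b \<sigma> (u k)" for k
  proof -
    have J\<theta>: "resolvent \<sigma> (subdifferential (fenchel_conjugate \<theta>)) (u k) = x (Suc k)"
      using \<sigma> x_subdiff[of k]
      by (intro resolvent_subdifferential_eqI proper_fenchel_conjugate[OF \<theta>(1)]
          subdifferential_fenchel_conjugate[OF \<theta>(1)]) (auto simp: u_x)
    \<comment> \<open>By \<open>u_x\<close> the reflected point \<open>2 x - u\<close> is
      \<open>x + \<sigma> z\<close>, so the argument of the projection differs from
      \<open>p (Suc k)\<close> only by a vector in the range of the adjoint.\<close>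
    have "2 *\<^sub>R x (Suc k) - u k - \<sigma> *\<^sub>R (Q (x (Suc k)) + c)
        = p (Suc k) - \<sigma> *\<^sub>R adjoint A (y (Suc (Suc k)))"
      unfolding u_x p_def by (simp add: algebra_simps scaleR_2)
    then have "Gamma_op \<theta> Q c A b \<sigma> (u k) = u k - x (Suc k) + p (Suc k)"
      using resolvent_normal_cone_affine[OF \<open>linear A\<close> \<sigma> p]
      by (simp add: Gamma_op_def J\<theta> gradient_quad[OF assms(2,3)])
    \<comment> \<open>Both sides equal \<open>u k + \<rho> (p (Suc k) - x (Suc k))\<close>.\<close>
    then show ?thesis
      by (simp add: u_p[of "Suc k"] u_x[of k, symmetric] scaleR_diff_left scaleR_add_right
          scaleR_diff_right)
  qed
  with u_x show ?thesis
    by blast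
qed

end
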